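(* Let $H$ be a nonzero complex Hilbert space and let $A \subseteq B(H)$ be a unital $C^*$-algebra with unit $I_H$. Then for every $X \in A$ we have $\|X\|_{\mathrm{op}} \leq \|X\|_{\mathrm{dec}}$.
   Context: $A$ is regarded as an ordered $*$-vector space with its usual involution, $A^+$ the usual cone of positive elements, $A_h$ the self-adjoint elements, and (Archimedean) order unit $e=I_H$. $\|\cdot\|_{\mathrm{op}}$ is the usual $C^*$-algebra (operator) norm. For $v,w\in A_h$, $v\ge w$ means $v-w\in A^+$, and the order norm on $A_h$ is $\|v\|:=\inf\{r\in\mathbb{R}: re+v\ge0\text{ and }re-v\ge0\}$. The decomposition norm on $A$ is $$\|X\|_{\mathrm{dec}} := \inf \left\{ \left\| \sum_{i=1}^n |\lambda_i|P_i \right\| : X = \sum_{i=1}^n \lambda_i P_i \text{ with } P_i \in A^+ \text{ and } \lambda_i \in \mathbb{C} \right\}.$$ *)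

theory Defs
  imports "HOL-Analysis.Analysis"
begin

class complex_vector = real_vector +
  fixes scaleC :: "complex \<Rightarrow> 'a \<Rightarrow> 'a"  (infixr \<open>*\<^sub>C\<close> 75)
  assumes scaleC_add_right: "a *\<^sub>C (x + y) = a *\<^sub>C x + a *\<^sub>C y"
    and scaleC_add_left: "(a + b) *\<^sub>C x = a *\<^sub>C x + b *\<^sub>C x"
    and scaleC_scaleC: "a *\<^sub>C b *\<^sub>C x = (a * b) *\<^sub>C x"
    and scaleC_one: "1 *\<^sub>C x = x"
    and scaleR_scaleC: "r *\<^sub>R x = complex_of_real r *\<^sub>C x"

class complex_normed_vector = complex_vector + real_normed_vector +
  assumes norm_scaleC: "norm (a *\<^sub>C x) = cmod a * norm x"

text \<open>
  The inner product is linear in the first argument. The norm axioms inherited from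
  \<^class>\<open>complex_normed_vector\<close> follow from the inner product axioms together with
  \<open>norm_eq_sqrt_cinner\<close>, so they do not restrict the class of complex Hilbert spaces.
\<close>

class complex_hilbert = complex_normed_vector + complete_space +
  fixes cinner :: "'a \<Rightarrow> 'a \<Rightarrow> complex"
  assumes cinner_commute: "cinner x y = cnj (cinner y x)"
    and cinner_add_left: "cinner (x + y) z = cinner x z + cinner y z"
    and cinner_scaleC_left: "cinner (a *\<^sub>C x) y = a * cinner x y"
    and cinner_nonneg: "cinner x x \<in> \<real>\<^sub>\<ge>\<^sub>0"
    and cinner_eq_zero: "cinner x x = 0 \<longleftrightarrow> x = 0"
    and norm_eq_sqrt_cinner: "norm x = sqrt (Re (cinner x x))"

instantiation complex :: complex_hilbert
begin

definition scaleC_complex :: "complex \<Rightarrow> complex \<Rightarrow> complex" where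
  "scaleC_complex a x = a * x"

definition cinner_complex :: "complex \<Rightarrow> complex \<Rightarrow> complex" where
  "cinner_complex x y = x * cnj y"

instance
proof
  fix x :: complex
  show "cinner x x \<in> \<real>\<^sub>\<ge>\<^sub>0"
    by (simp add: cinner_complex_def complex_nonneg_Reals_iff)
  show "norm x = sqrt (Re (cinner x x))"
    by (simp add: cinner_complex_def cmod_def power2_eq_square)
qed (auto simp: scaleC_complex_def cinner_complex_def algebra_simps norm_mult
      scaleR_conv_of_real)

end

instantiation blinfun :: (real_normed_vector, complex_normed_vector) complex_normed_vector
begin

lift_definition scaleC_blinfun :: "complex \<Rightarrow> 'a \<Rightarrow>\<^sub>L 'b \<Rightarrow> 'a \<Rightarrow>\<^sub>L 'b" is
  "\<lambda>a f x. a *\<^sub>C f x"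
proof -
  fix a :: complex and f :: "'a \<Rightarrow> 'b"
  assume f: "bounded_linear f"
  interpret f: bounded_linear f by (fact f)
  show "bounded_linear (\<lambda>x. a *\<^sub>C f x)"
  proof (rule bounded_linear_intro[where K = "cmod a * onorm f"])
    fix x y :: 'a and r :: real
    show "a *\<^sub>C f (x + y) = a *\<^sub>C f x + a *\<^sub>C f y"
      by (simp add: f.add scaleC_add_right)
    show "a *\<^sub>C f (r *\<^sub>R x) = r *\<^sub>R (a *\<^sub>C f x)"
      by (simp add: f.scaleR scaleR_scaleC scaleC_scaleC mult.commute)
    show "norm (a *\<^sub>C f x) \<le> norm x * (cmod a * onorm f)"
      using mult_left_mono[OF onorm[OF f, of x], of "cmod a"]
      by (simp add: norm_scaleC ac_simps)
  qed
qed

instance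
proof
  fix a b :: complex and r :: real and f g :: "'a \<Rightarrow>\<^sub>L 'b"
  show "a *\<^sub>C (f + g) = a *\<^sub>C f + a *\<^sub>C g"
    by transfer (simp add: scaleC_add_right)
  show "(a + b) *\<^sub>C f = a *\<^sub>C f + b *\<^sub>C f"
    by transfer (simp add: scaleC_add_left)
  show "a *\<^sub>C b *\<^sub>C f = (a * b) *\<^sub>C f"
    by transfer (simp add: scaleC_scaleC)
  show "1 *\<^sub>C f = f"
    by transfer (simp add: scaleC_one)
  show "r *\<^sub>R f = complex_of_real r *\<^sub>C f"
    by transfer (simp add: scaleR_scaleC)
  have "onorm (\<lambda>x. a *\<^sub>C h x) = onorm (\<lambda>x. cmod a *\<^sub>R h x)" for h :: "'a \<Rightarrow> 'b"
    by (simp add: onorm_def norm_scaleC)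
  then show "norm (a *\<^sub>C f) = cmod a * norm f"
    by transfer (simp add: onorm_scaleR)
qed

end

text \<open>
  Elements of \<^typ>\<open>'h \<Rightarrow>\<^sub>L 'h\<close> are real-linear, so \<open>B(H)\<close> is the subset of complex-linear ones;
  \<^const>\<open>norm\<close> on this type is the operator norm.
\<close>

definition bounded_ops :: "('h::complex_hilbert \<Rightarrow>\<^sub>L 'h) set" where
  "bounded_ops = {T :: 'h \<Rightarrow>\<^sub>L 'h. \<forall>a x. T (a *\<^sub>C x) = a *\<^sub>C T x}"

text \<open>\<open>is_adjoint T S\<close> says \<open>S = T\<^sup>*\<close>; the adjoint is unique by \<open>is_adjoint_unique\<close> below.\<close>

definition is_adjoint :: "('h::complex_hilbert \<Rightarrow>\<^sub>L 'h) \<Rightarrow> ('h \<Rightarrow>\<^sub>L 'h) \<Rightarrow> bool" where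
  "is_adjoint T S \<longleftrightarrow> (\<forall>x y. cinner (T x) y = cinner x (S y))"

lemma is_adjoint_unique:
  assumes "is_adjoint T S" "is_adjoint T S'"
  shows "S = S'"
proof (rule blinfun_eqI)
  fix y
  have eq: "cinner (S y) x = cinner (S' y) x" for x
    using assms cinner_commute unfolding is_adjoint_def by metis
  have "cinner (S y) x = cinner (S y - S' y) x + cinner (S' y) x" for x
    using cinner_add_left[of "S y - S' y" "S' y" x] by simp
  then have "cinner (S y - S' y) x = 0" for x
    using eq[of x] by simp
  then show "S y = S' y"
    using cinner_eq_zero[of "S y - S' y"] by simp
qed

definition unital_cstar_algebra :: "('h::complex_hilbert \<Rightarrow>\<^sub>L 'h) set \<Rightarrow> bool" where
  "unital_cstar_algebra A \<longleftrightarrow>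
     A \<subseteq> bounded_ops \<and>
     id_blinfun \<in> A \<and>
     (\<forall>S\<in>A. \<forall>T\<in>A. S + T \<in> A) \<and>
     (\<forall>a. \<forall>T\<in>A. a *\<^sub>C T \<in> A) \<and>
     (\<forall>S\<in>A. \<forall>T\<in>A. S o\<^sub>L T \<in> A) \<and>
     (\<forall>T\<in>A. \<exists>S\<in>A. is_adjoint T S) \<and>
     closed A"

definition self_adjoint_part :: "('h::complex_hilbert \<Rightarrow>\<^sub>L 'h) set \<Rightarrow> ('h \<Rightarrow>\<^sub>L 'h) set" where
  "self_adjoint_part A = {T \<in> A. is_adjoint T T}"

definition positive_cone :: "('h::complex_hilbert \<Rightarrow>\<^sub>L 'h) set \<Rightarrow> ('h \<Rightarrow>\<^sub>L 'h) set" where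
  "positive_cone A = {T \<in> self_adjoint_part A. \<forall>x. cinner (T x) x \<in> \<real>\<^sub>\<ge>\<^sub>0}"

definition cone_ge :: "('h::complex_hilbert \<Rightarrow>\<^sub>L 'h) set \<Rightarrow> ('h \<Rightarrow>\<^sub>L 'h) \<Rightarrow> ('h \<Rightarrow>\<^sub>L 'h) \<Rightarrow> bool" where
  "cone_ge A v w \<longleftrightarrow> v - w \<in> positive_cone A"

text \<open>
  Only meaningful for \<open>v \<in> self_adjoint_part A\<close> and \<open>H \<noteq> {0}\<close>; otherwise the infimum may be
  taken over the empty set or over all of \<open>\<real>\<close>.
\<close>

definition order_norm :: "('h::complex_hilbert \<Rightarrow>\<^sub>L 'h) set \<Rightarrow> ('h \<Rightarrow>\<^sub>L 'h) \<Rightarrow> real" where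
  "order_norm A v =
     Inf {r::real. cone_ge A (r *\<^sub>R id_blinfun + v) 0 \<and> cone_ge A (r *\<^sub>R id_blinfun - v) 0}"

definition decomposition_norm :: "('h::complex_hilbert \<Rightarrow>\<^sub>L 'h) set \<Rightarrow> ('h \<Rightarrow>\<^sub>L 'h) \<Rightarrow> real" where
  "decomposition_norm A X =
     Inf {order_norm A (\<Sum>i=1..n. cmod (c i) *\<^sub>R P i) | (n::nat) c P.
            X = (\<Sum>i=1..n. c i *\<^sub>C P i) \<and> (\<forall>i\<in>{1..n}. P i \<in> positive_cone A)}"

end

theory Submission
  imports Defs
begin

text \<open>
  Let \<open>X = \<Sum>i. c\<^sub>i P\<^sub>i\<close> with all \<open>P\<^sub>i\<close> positive, and put \<open>T = \<Sum>i. \<bar>c\<^sub>i\<bar> P\<^sub>i\<close>. Positivity of \<open>P\<close>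
  at the vector \<open>\<zeta> u - v\<close>, with \<open>\<zeta>\<close> the phase of \<open>c\<close>, gives
  \<open>2 Re (c \<langle>P u, v\<rangle>) \<le> \<bar>c\<bar> (\<langle>P u, u\<rangle> + \<langle>P v, v\<rangle>)\<close>
  (\<open>positive_cone_Re_cinner_le\<close>), and summation over the decomposition gives
  \<open>2 Re \<langle>X x, y\<rangle> \<le> \<langle>T x, x\<rangle> + \<langle>T y, y\<rangle>\<close>. If \<open>T \<le> r I\<close>, then the right-hand side is at most
  \<open>r (\<parallel>x\<parallel>\<^sup>2 + \<parallel>y\<parallel>\<^sup>2)\<close>; taking \<open>y\<close> to be the positive multiple of \<open>X x\<close> with \<open>\<parallel>y\<parallel> = \<parallel>x\<parallel>\<close> yields
  \<open>\<parallel>X x\<parallel> \<le> r \<parallel>x\<parallel>\<close> (\<open>norm_le_of_decomposition\<close>). So \<open>\<parallel>X\<parallel>\<close> is a lower bound of the sets whose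
  infima define the order norm of \<open>T\<close> and the decomposition norm of \<open>X\<close>.

  Since the infimum of the empty set of reals is of no use, both sets must also be nonempty.
  For the order norm, \<open>\<parallel>T\<parallel> I \<plusminus> T\<close> is positive when \<open>T\<close> is self-adjoint
  (\<open>norm_id_plus_in_positive_cone\<close>). For the decomposition norm, with
  \<open>X = B + \<i> C\<close> the Cartesian decomposition,
  \<open>X = (B + \<parallel>B\<parallel> I) + \<i> (C + \<parallel>C\<parallel> I) - (\<parallel>B\<parallel> + \<i> \<parallel>C\<parallel>) I\<close>
  is a combination of three positive elements (\<open>exists_positive_decomposition\<close>).
\<close>

section \<open>Inner products\<close>

lemma cinner_add_right: "cinner x (y + z) = cinner x y + cinner x z"
  by (metis cinner_commute cinner_add_left complex_cnj_add)

lemma cinner_scaleC_right: "cinner x (a *\<^sub>C y) = cnj a * cinner x y"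
  by (metis cinner_commute cinner_scaleC_left complex_cnj_mult)

lemma cinner_scaleR_left: "cinner (r *\<^sub>R x) y = complex_of_real r * cinner x y"
  by (simp add: scaleR_scaleC cinner_scaleC_left)

lemma cinner_scaleR_right: "cinner x (r *\<^sub>R y) = complex_of_real r * cinner x y"
  by (simp add: scaleR_scaleC cinner_scaleC_right)

lemma cinner_diff_left: "cinner (x - y) z = cinner x z - cinner y z"
  using cinner_add_left[of "x - y" y z] by simp

lemma cinner_diff_right: "cinner x (y - z) = cinner x y - cinner x z"
  using cinner_add_right[of x "y - z" z] by simp

lemma cinner_zero_left: "cinner 0 y = 0"
  using cinner_diff_left[of 0 0 y] by simp

lemma cinner_sum_left: "cinner (\<Sum>i\<in>I. f i) y = (\<Sum>i\<in>I. cinner (f i) y)"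
  by (induction I rule: infinite_finite_induct) (auto simp: cinner_zero_left cinner_add_left)

lemma Re_cinner_self: "Re (cinner x x) = (norm x)\<^sup>2"
  using cinner_nonneg[of x] by (simp add: norm_eq_sqrt_cinner complex_nonneg_Reals_iff)

lemma Re_cinner_le: "Re (cinner x y) \<le> norm x * norm y"
proof -
  have "(norm (x + y))\<^sup>2 \<le> (norm x + norm y)\<^sup>2"
    by (intro power_mono norm_triangle_ineq) simp
  moreover have "Re (cinner y x) = Re (cinner x y)"
    by (subst cinner_commute) simp
  ultimately show ?thesis
    by (simp add: Re_cinner_self[symmetric] cinner_add_left cinner_add_right power2_sum)
qed

section \<open>Positive elements of a unital operator algebra\<close>

lemma blinfun_apply_scaleC: "blinfun_apply (a *\<^sub>C T) x = a *\<^sub>C T x"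
  by transfer simp

lemma blinfun_apply_sum: "blinfun_apply (\<Sum>i\<in>I. T i) x = (\<Sum>i\<in>I. T i x)"
  by (induction I rule: infinite_finite_induct) (auto simp: blinfun.add_left)

lemma unital_cstar_algebra_scaleR:
  "unital_cstar_algebra A \<Longrightarrow> T \<in> A \<Longrightarrow> r *\<^sub>R T \<in> A"
  by (simp add: unital_cstar_algebra_def scaleR_scaleC)

lemma unital_cstar_algebra_diff:
  assumes "unital_cstar_algebra A" "S \<in> A" "T \<in> A"
  shows "S - T \<in> A"
proof -
  have "S + (-1) *\<^sub>R T \<in> A"
    using assms unital_cstar_algebra_scaleR[OF assms(1,3), of "-1"]
    unfolding unital_cstar_algebra_def by blast
  then show ?thesis by simp
qed

lemma self_adjoint_part_add:
  assumes "unital_cstar_algebra A" "S \<in> self_adjoint_part A" "T \<in> self_adjoint_part A"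
  shows "S + T \<in> self_adjoint_part A"
  using assms
  by (auto simp: self_adjoint_part_def unital_cstar_algebra_def is_adjoint_def
      blinfun.add_left cinner_add_left cinner_add_right)

lemma self_adjoint_part_scaleR:
  assumes "unital_cstar_algebra A" "T \<in> self_adjoint_part A"
  shows "r *\<^sub>R T \<in> self_adjoint_part A"
  using assms
  by (auto simp: self_adjoint_part_def unital_cstar_algebra_scaleR is_adjoint_def
      blinfun.scaleR_left cinner_scaleR_left cinner_scaleR_right)

lemma id_in_self_adjoint_part:
  "unital_cstar_algebra A \<Longrightarrow> id_blinfun \<in> self_adjoint_part A"
  by (simp add: self_adjoint_part_def unital_cstar_algebra_def is_adjoint_def)

lemma self_adjoint_part_sum:
  assumes "unital_cstar_algebra A" "\<And>i. i \<in> I \<Longrightarrow> T i \<in> self_adjoint_part A"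
  shows "(\<Sum>i\<in>I. T i) \<in> self_adjoint_part A"
  using assms(2)
proof (induction I rule: infinite_finite_induct)
  case (insert i I)
  then show ?case by (simp add: self_adjoint_part_add[OF assms(1)])
qed (use self_adjoint_part_scaleR[OF assms(1) id_in_self_adjoint_part[OF assms(1)], of 0]
     in simp_all)

lemma self_adjoint_positiveI:
  assumes "T \<in> self_adjoint_part A" "\<And>x. 0 \<le> Re (cinner (T x) x)"
  shows "T \<in> positive_cone A"
proof -
  have "Im (cinner (T x) x) = 0" for x
  proof -
    have "cinner (T x) x = cnj (cinner (T x) x)"
      using assms(1) cinner_commute[of "T x" x]
      by (simp add: self_adjoint_part_def is_adjoint_def)
    then show ?thesis by (simp add: complex_eq_iff)
  qed
  with assms show ?thesis
    by (simp add: positive_cone_def complex_nonneg_Reals_iff)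
qed

lemma norm_id_plus_in_positive_cone:
  assumes "unital_cstar_algebra A" "T \<in> self_adjoint_part A"
  shows "norm T *\<^sub>R id_blinfun + T \<in> positive_cone A"
proof (rule self_adjoint_positiveI)
  show "norm T *\<^sub>R id_blinfun + T \<in> self_adjoint_part A"
    using assms by (intro self_adjoint_part_add self_adjoint_part_scaleR id_in_self_adjoint_part)
  fix x
  have "Re (cinner ((- T) x) x) \<le> norm ((- T) x) * norm x"
    by (rule Re_cinner_le)
  also have "\<dots> \<le> (norm T * norm x) * norm x"
    using norm_blinfun[of "- T" x] by (intro mult_right_mono) auto
  finally have "- Re (cinner (T x) x) \<le> norm T * (norm x)\<^sup>2"
    using cinner_diff_left[of 0 "T x" x]
    by (simp add: blinfun.minus_left cinner_zero_left power2_eq_square)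
  then show "0 \<le> Re (cinner ((norm T *\<^sub>R id_blinfun + T) x) x)"
    by (simp add: blinfun.add_left blinfun.scaleR_left cinner_add_left cinner_scaleR_left
        Re_cinner_self)
qed

lemma norm_in_order_norm_set:
  assumes "unital_cstar_algebra A" "T \<in> self_adjoint_part A"
  shows "cone_ge A (norm T *\<^sub>R id_blinfun + T) 0 \<and> cone_ge A (norm T *\<^sub>R id_blinfun - T) 0"
  using norm_id_plus_in_positive_cone[OF assms]
    norm_id_plus_in_positive_cone[OF assms(1) self_adjoint_part_scaleR[OF assms, of "-1"]]
  by (simp add: cone_ge_def)

section \<open>Bounding the operator norm by a decomposition\<close>

lemma positive_cone_Re_cinner_le:
  assumes "unital_cstar_algebra A" "P \<in> positive_cone A"
  shows "2 * Re (c * cinner (P u) v) \<le> cmod c * (Re (cinner (P u) u) + Re (cinner (P v) v))"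
proof -
  have lin: "P (a *\<^sub>C x) = a *\<^sub>C P x" for a x
    using assms
    by (auto simp: unital_cstar_algebra_def positive_cone_def self_adjoint_part_def bounded_ops_def)
  have adj: "cinner (P x) y = cinner x (P y)" for x y
    using assms by (auto simp: positive_cone_def self_adjoint_part_def is_adjoint_def)
  define z where "z = sgn c"
  have c: "c = cmod c * z"
    by (simp add: z_def sgn_div_norm scaleR_conv_of_real field_simps)
  show ?thesis
  proof (cases "c = 0")
    case False
    then have z: "z * cnj z = 1"
      by (simp add: z_def complex_norm_square[symmetric] norm_sgn)
    define p where "p = z * cinner (P u) v"
    have "cinner (P v) (z *\<^sub>C u) = cnj p"
      using adj[of v u] cinner_commute[of v "P u"] by (simp add: p_def cinner_scaleC_right)
    moreover have "cinner (P (z *\<^sub>C u)) (z *\<^sub>C u) = (z * cnj z) * cinner (P u) u"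
      by (simp add: lin cinner_scaleC_left cinner_scaleC_right)
    ultimately have "cinner (P (z *\<^sub>C u - v)) (z *\<^sub>C u - v)
        = cinner (P u) u - p - cnj p + cinner (P v) v"
      by (simp add: blinfun.diff_right cinner_diff_left cinner_diff_right z)
         (simp add: lin cinner_scaleC_left p_def)
    moreover have "0 \<le> Re (cinner (P (z *\<^sub>C u - v)) (z *\<^sub>C u - v))"
      using assms(2) by (simp add: positive_cone_def complex_nonneg_Reals_iff)
    ultimately have "2 * Re p \<le> Re (cinner (P u) u) + Re (cinner (P v) v)"
      by simp
    moreover have "c * cinner (P u) v = complex_of_real (cmod c) * p"
      using arg_cong[OF c, of "\<lambda>a. a * cinner (P u) v"] by (simp add: p_def mult.assoc)
    then have "Re (c * cinner (P u) v) = cmod c * Re p"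
      by simp
    ultimately show ?thesis
      using mult_left_mono[of "2 * Re p" _ "cmod c"] by (simp add: mult.left_commute)
  qed simp
qed

lemma norm_le_of_decomposition:
  fixes A :: "('h::complex_hilbert \<Rightarrow>\<^sub>L 'h) set"
  assumes "(UNIV :: 'h set) \<noteq> {0}" and A: "unital_cstar_algebra A"
    and P: "\<And>i. i \<in> I \<Longrightarrow> P i \<in> positive_cone A"
    and r: "cone_ge A (r *\<^sub>R id_blinfun - (\<Sum>i\<in>I. cmod (c i) *\<^sub>R P i)) 0"
  shows "norm (\<Sum>i\<in>I. c i *\<^sub>C P i) \<le> r"
proof -
  define X where "X = (\<Sum>i\<in>I. c i *\<^sub>C P i)"
  define T where "T = (\<Sum>i\<in>I. cmod (c i) *\<^sub>R P i)"
  define q where "q x = Re (cinner (T x) x)" for x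
  have q: "q x = (\<Sum>i\<in>I. cmod (c i) * Re (cinner (P i x) x))" for x
    by (simp add: q_def T_def blinfun_apply_sum blinfun.scaleR_left cinner_sum_left
        cinner_scaleR_left)
  have q_nonneg: "0 \<le> q x" for x
    unfolding q using P
    by (intro sum_nonneg mult_nonneg_nonneg) (auto simp: positive_cone_def complex_nonneg_Reals_iff)
  have q_le: "q x \<le> r * (norm x)\<^sup>2" for x
  proof -
    have "0 \<le> Re (cinner ((r *\<^sub>R id_blinfun - T) x) x)"
      using r by (simp add: T_def cone_ge_def positive_cone_def complex_nonneg_Reals_iff)
    then show ?thesis
      by (simp add: q_def blinfun.diff_left blinfun.scaleR_left cinner_diff_left
          cinner_scaleR_left Re_cinner_self)
  qed
  have X_le: "2 * Re (cinner (X x) y) \<le> q x + q y" for x y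
  proof -
    have "2 * Re (cinner (X x) y) = (\<Sum>i\<in>I. 2 * Re (c i * cinner (P i x) y))"
      by (simp add: X_def blinfun_apply_sum blinfun_apply_scaleC cinner_sum_left
          cinner_scaleC_left sum_distrib_left)
    also have "\<dots> \<le> (\<Sum>i\<in>I. cmod (c i) * (Re (cinner (P i x) x) + Re (cinner (P i y) y)))"
      by (intro sum_mono positive_cone_Re_cinner_le[OF A] P)
    finally show ?thesis
      by (simp add: q sum.distrib distrib_left)
  qed
  \<comment> \<open>Here \<open>H \<noteq> {0}\<close> enters: on the zero space \<open>r\<close> could be negative.\<close>
  obtain x0 :: 'h where "x0 \<noteq> 0"
    using assms(1) by auto
  moreover have "0 \<le> r * (norm x0)\<^sup>2"
    using q_nonneg q_le by (rule order_trans)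
  ultimately have "0 \<le> r"
    by (simp add: zero_le_mult_iff)
  moreover have "norm (X x) \<le> r * norm x" for x
  proof (cases "X x = 0")
    case False
    then have "x \<noteq> 0" by auto
    define y where "y = (norm x / norm (X x)) *\<^sub>R X x"
    have "norm y = norm x"
      using False by (simp add: y_def)
    moreover have "Re (cinner (X x) y) = norm x * norm (X x)"
      using False by (simp add: y_def cinner_scaleR_right Re_cinner_self power2_eq_square)
    ultimately have "2 * (norm x * norm (X x)) \<le> 2 * (r * (norm x)\<^sup>2)"
      using X_le[of x y] q_le[of x] q_le[of y] by simp
    then have "norm x * norm (X x) \<le> norm x * (r * norm x)"
      by (simp add: power2_eq_square mult.left_commute)
    with \<open>x \<noteq> 0\<close> show ?thesis
      by (simp add: mult_le_cancel_left)
  qed (use \<open>0 \<le> r\<close> in simp)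
  ultimately show ?thesis
    unfolding X_def[symmetric] by (intro norm_blinfun_bound)
qed

section \<open>Existence of decompositions\<close>

lemma cartesian_decomposition:
  assumes A: "unital_cstar_algebra A" and "X \<in> A"
  obtains B C where "B \<in> self_adjoint_part A" "C \<in> self_adjoint_part A" "X = B + \<i> *\<^sub>C C"
proof -
  obtain S where "S \<in> A" and S: "is_adjoint X S"
    using assms by (auto simp: unital_cstar_algebra_def)
  have XS: "cinner (X x) y = cinner x (S y)" for x y
    using S by (simp add: is_adjoint_def)
  have SX: "cinner (S x) y = cinner x (X y)" for x y
    by (metis XS cinner_commute)
  define B where "B = (1/2::complex) *\<^sub>C (X + S)"
  define C where "C = (- \<i>/2) *\<^sub>C (X - S)"
  have "B \<in> A" "C \<in> A"
    using A \<open>X \<in> A\<close> \<open>S \<in> A\<close> unital_cstar_algebra_diff[OF A \<open>X \<in> A\<close> \<open>S \<in> A\<close>]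
    unfolding B_def C_def unital_cstar_algebra_def by blast+
  moreover have "is_adjoint B B"
    by (simp add: is_adjoint_def B_def blinfun_apply_scaleC blinfun.add_left cinner_scaleC_left
        cinner_scaleC_right cinner_add_left cinner_add_right XS SX)
  moreover have "is_adjoint C C"
    by (simp add: is_adjoint_def C_def blinfun_apply_scaleC blinfun.diff_left cinner_scaleC_left
        cinner_scaleC_right cinner_diff_left cinner_diff_right XS SX algebra_simps)
  moreover have "X = B + \<i> *\<^sub>C C"
  proof -
    have "B + \<i> *\<^sub>C C = (1/2::real) *\<^sub>R (X + S) + (1/2::real) *\<^sub>R (X - S)"
      by (simp add: B_def C_def scaleC_scaleC scaleR_scaleC)
    also have "\<dots> = (1/2::real) *\<^sub>R X + (1/2::real) *\<^sub>R X"
      by (simp add: algebra_simps)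
    also have "\<dots> = X"
      by (simp flip: scaleR_add_left)
    finally show ?thesis ..
  qed
  ultimately show thesis
    by (intro that) (auto simp: self_adjoint_part_def)
qed

lemma exists_positive_decomposition:
  assumes A: "unital_cstar_algebra A" and "X \<in> A"
  shows "\<exists>(n::nat) c P. X = (\<Sum>i=1..n. c i *\<^sub>C P i) \<and> (\<forall>i\<in>{1..n}. P i \<in> positive_cone A)"
proof -
  obtain B C where B: "B \<in> self_adjoint_part A" and C: "C \<in> self_adjoint_part A"
    and X: "X = B + \<i> *\<^sub>C C"
    using cartesian_decomposition[OF assms] .
  define c :: "nat \<Rightarrow> complex" where
    "c i = (if i = 1 then 1 else if i = 2 then \<i> else - (norm B + \<i> * norm C))" for i
  define P where
    "P i = (if i = 1 then norm B *\<^sub>R id_blinfun + B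
            else if i = 2 then norm C *\<^sub>R id_blinfun + C else id_blinfun)" for i :: nat
  have "id_blinfun \<in> positive_cone A"
    by (intro self_adjoint_positiveI id_in_self_adjoint_part A) (simp add: Re_cinner_self)
  then have "\<forall>i\<in>{1..3}. P i \<in> positive_cone A"
    using norm_id_plus_in_positive_cone[OF A B] norm_id_plus_in_positive_cone[OF A C]
    by (simp add: P_def)
  moreover have "(\<Sum>i=1..3. c i *\<^sub>C P i)
      = B + \<i> *\<^sub>C C + (norm B + \<i> * norm C + - (norm B + \<i> * norm C)) *\<^sub>C id_blinfun"
    unfolding scaleC_add_left
    by (simp add: c_def P_def numeral_3_eq_3 scaleC_one scaleC_add_right scaleR_scaleC
        scaleC_scaleC algebra_simps)
  then have "(\<Sum>i=1..3. c i *\<^sub>C P i) = X"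
    using scaleR_scaleC[of 0 "id_blinfun :: 'a \<Rightarrow>\<^sub>L 'a"] by (simp add: X)
  ultimately show ?thesis
    by metis
qed

section \<open>The operator norm and the decomposition norm\<close>

theorem proposition5p10:
  fixes A :: "('h::complex_hilbert \<Rightarrow>\<^sub>L 'h) set" and X :: "'h \<Rightarrow>\<^sub>L 'h"
  assumes "(UNIV :: 'h set) \<noteq> {0}"
    and "unital_cstar_algebra A"
    and "X \<in> A"
  shows "norm X \<le> decomposition_norm A X"
  unfolding decomposition_norm_def
proof (rule cInf_greatest)
  show "{order_norm A (\<Sum>i=1..n. cmod (c i) *\<^sub>R P i) | (n::nat) c P.
      X = (\<Sum>i=1..n. c i *\<^sub>C P i) \<and> (\<forall>i\<in>{1..n}. P i \<in> positive_cone A)} \<noteq> {}"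
    using exists_positive_decomposition[OF assms(2,3)] by blast
next
  fix t
  assume "t \<in> {order_norm A (\<Sum>i=1..n. cmod (c i) *\<^sub>R P i) | (n::nat) c P.
      X = (\<Sum>i=1..n. c i *\<^sub>C P i) \<and> (\<forall>i\<in>{1..n}. P i \<in> positive_cone A)}"
  then obtain n :: nat and c P where t: "t = order_norm A (\<Sum>i=1..n. cmod (c i) *\<^sub>R P i)"
    and X: "X = (\<Sum>i=1..n. c i *\<^sub>C P i)"
    and P: "\<And>i. i \<in> {1..n} \<Longrightarrow> P i \<in> positive_cone A"
    by blast
  define T where "T = (\<Sum>i=1..n. cmod (c i) *\<^sub>R P i)"
  have "T \<in> self_adjoint_part A"
    unfolding T_def using P
    by (intro self_adjoint_part_sum self_adjoint_part_scaleR assms(2))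
       (simp add: positive_cone_def)
  note T = norm_in_order_norm_set[OF assms(2) this]
  have "norm X \<le> Inf {r. cone_ge A (r *\<^sub>R id_blinfun + T) 0 \<and> cone_ge A (r *\<^sub>R id_blinfun - T) 0}"
  proof (rule cInf_greatest)
    fix r
    assume "r \<in> {r. cone_ge A (r *\<^sub>R id_blinfun + T) 0 \<and> cone_ge A (r *\<^sub>R id_blinfun - T) 0}"
    then show "norm X \<le> r"
      unfolding X T_def by (intro norm_le_of_decomposition[OF assms(1,2) P]) auto
  qed (use T in blast)
  then show "norm X \<le> t"
    by (simp add: t order_norm_def T_def)
qed

end
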